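(* Given the $\epsilon$-strip $\Omega_\epsilon\subset\mathbb{S}^n(1)$ around the equator $E=\{(x_1,\dots,x_{n+1})\in\mathbb{S}^n(1):x_{n+1}=0\}$, with $\epsilon\in(0,\pi/2)$, there exists an absolute constant $\delta>0$ (absolute in the sense that it does not depend on $n$) such that $$\frac{\mathrm{vol}\left(\Omega_\epsilon\right)}{\mathrm{vol}\left(\mathbb{S}^n(1)\right)}\ \ge\ 1-4e^{-\delta\,\bar\epsilon^{2}(n+1)},$$ where $\bar\epsilon=\sin\epsilon\in(0,1)$, and hence $$\lim_{n\to\infty}\frac{\mathrm{vol}\left(\Omega_\epsilon\right)}{\mathrm{vol}\left(\mathbb{S}^n(1)\right)}=1.$$
   Context: $\mathbb{S}^n(1)\subset\mathbb{R}^{n+1}$ is the unit sphere with its round metric of constant sectional curvature $1$, $\mathrm{vol}$ is the $n$-dimensional Riemannian volume, and $$\Omega_\epsilon=\{(x_1,\dots,x_{n+1})\in\mathbb{S}^n(1): -\sin\epsilon<x_{n+1}<\sin\epsilon\}.$$ *)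

theory Defs
  imports "HOL-Analysis.Analysis" "Jordan_Normal_Form.Determinant"
begin

text \<open>
  The dimension has to vary inside the statement, so points of \<open>\<real>\<^sup>d\<close> are extensional functions on
  \<open>{..<d}\<close>, with the product of the one-dimensional Lebesgue measures. Indices start at 0: the
  coordinates \<open>x\<^sub>1, \<dots>, x\<^sub>n\<^sub>+\<^sub>1\<close> of a point of \<open>\<real>\<^sup>n\<^sup>+\<^sup>1\<close> are \<open>x 0, \<dots>, x n\<close>.
\<close>

definition euclid :: "nat \<Rightarrow> (nat \<Rightarrow> real) set" where
  "euclid d = ({..<d} \<rightarrow>\<^sub>E UNIV)"

definition leb :: "nat \<Rightarrow> (nat \<Rightarrow> real) measure" where
  "leb d = (\<Pi>\<^sub>M i\<in>{..<d}. lborel)"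

definition norm_sq :: "nat \<Rightarrow> (nat \<Rightarrow> real) \<Rightarrow> real" where
  "norm_sq d x = (\<Sum>i<d. (x i)\<^sup>2)"

definition unit_sphere :: "nat \<Rightarrow> (nat \<Rightarrow> real) set" where
  "unit_sphere n = {x \<in> euclid (n + 1). norm_sq (n + 1) x = 1}"

definition strip :: "nat \<Rightarrow> real \<Rightarrow> (nat \<Rightarrow> real) set" where
  "strip n \<epsilon> = {x \<in> unit_sphere n. - sin \<epsilon> < x n \<and> x n < sin \<epsilon>}"


section \<open>Riemannian volume of a parametrized submanifold\<close>

text \<open>
  \<open>\<phi>\<close> is a local parametrization \<open>\<real>\<^sup>d \<rightarrow> \<real>\<^sup>m\<close> of a \<open>d\<close>-dimensional submanifold; the metric is the one
  induced by the Euclidean inner product of \<open>\<real>\<^sup>m\<close>.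
\<close>

definition partial_deriv ::
    "((nat \<Rightarrow> real) \<Rightarrow> (nat \<Rightarrow> real)) \<Rightarrow> nat \<Rightarrow> (nat \<Rightarrow> real) \<Rightarrow> nat \<Rightarrow> real" where
  "partial_deriv \<phi> i u k = deriv (\<lambda>t. \<phi> (u(i := t)) k) (u i)"

definition induced_metric ::
    "nat \<Rightarrow> nat \<Rightarrow> ((nat \<Rightarrow> real) \<Rightarrow> (nat \<Rightarrow> real)) \<Rightarrow> (nat \<Rightarrow> real) \<Rightarrow> real mat" where
  "induced_metric d m \<phi> u =
     Matrix.mat d d (\<lambda>(i, j). \<Sum>k<m. partial_deriv \<phi> i u k * partial_deriv \<phi> j u k)"

text \<open>
  \<open>\<integral>\<surd>(det g)\<close> over each chart of an atlas. The \<open>j\<close>-th chart only contributes the part of \<open>A\<close> not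
  covered by the earlier ones, so that nothing is counted twice.
\<close>

definition riemannian_volume ::
    "nat \<Rightarrow> nat \<Rightarrow> ((nat \<Rightarrow> real) \<Rightarrow> (nat \<Rightarrow> real)) list \<Rightarrow> (nat \<Rightarrow> real) set \<Rightarrow> ennreal" where
  "riemannian_volume d m \<phi>s A =
     (\<Sum>j<length \<phi>s.
        \<integral>\<^sup>+u. ennreal (sqrt (Determinant.det (induced_metric d m (\<phi>s ! j) u)))
              * indicator (A - (\<Union>i<j. (\<phi>s ! i) ` euclid d)) ((\<phi>s ! j) u) \<partial>leb d)"


section \<open>The round sphere\<close>

text \<open>
  Inverse stereographic projection from the pole \<open>(0, \<dots>, 0, s)\<close>, where \<open>s\<close> is \<open>1\<close> or \<open>-1\<close>; it
  parametrizes the whole sphere except that pole.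
\<close>

definition stereo :: "nat \<Rightarrow> real \<Rightarrow> (nat \<Rightarrow> real) \<Rightarrow> (nat \<Rightarrow> real)" where
  "stereo n s u =
     (\<lambda>k\<in>{..<n + 1}. if k < n then 2 * u k / (norm_sq n u + 1)
                     else s * (norm_sq n u - 1) / (norm_sq n u + 1))"

definition sphere_vol :: "nat \<Rightarrow> (nat \<Rightarrow> real) set \<Rightarrow> real" where
  "sphere_vol n A = enn2real (riemannian_volume n (n + 1) [stereo n 1, stereo n (- 1)] A)"

lemma norm_sq_nonneg: "0 \<le> norm_sq n u"
  by (simp add: norm_sq_def sum_nonneg)

lemma stereo_inj: "inj_on (stereo n s) (euclid n)" if s: "s = 1 \<or> s = - 1"
proof (rule inj_onI)
  fix u v assume u: "u \<in> euclid n" and v: "v \<in> euclid n" and eq: "stereo n s u = stereo n s v"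
  have pos: "norm_sq n u + 1 > 0" "norm_sq n v + 1 > 0"
    using norm_sq_nonneg[of n u] norm_sq_nonneg[of n v] by linarith+
  have "s * (norm_sq n u - 1) / (norm_sq n u + 1) = s * (norm_sq n v - 1) / (norm_sq n v + 1)"
    using fun_cong[OF eq, of n] by (simp add: stereo_def)
  then have "(norm_sq n u - 1) * (norm_sq n v + 1) = (norm_sq n v - 1) * (norm_sq n u + 1)"
    using s pos by (auto simp: divide_simps)
  then have ns: "norm_sq n u = norm_sq n v"
    by (simp add: algebra_simps)
  have "u k = v k" if "k < n" for k
    using fun_cong[OF eq, of k] that pos ns by (simp add: stereo_def)
  then show "u = v"
    using u v unfolding euclid_def by (intro PiE_ext) auto
qed

lemma stereo_image:
  assumes s: "s = 1 \<or> s = - 1"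
  shows "stereo n s ` euclid n = {x \<in> unit_sphere n. x n \<noteq> s}"
proof (intro equalityI subsetI)
  fix x assume "x \<in> stereo n s ` euclid n"
  then obtain u where x: "x = stereo n s u" by blast
  define q where "q = norm_sq n u"
  have q: "q + 1 > 0" using norm_sq_nonneg[of n u] by (simp add: q_def)
  have ss: "s\<^sup>2 = 1" using s by auto
  have "(\<Sum>i<n. (x i)\<^sup>2) = (\<Sum>i<n. 4 * (u i)\<^sup>2 / (q + 1)\<^sup>2)"
    by (intro sum.cong) (auto simp: x stereo_def q_def power_divide power_mult_distrib)
  also have "\<dots> = 4 * q / (q + 1)\<^sup>2"
    by (simp add: q_def norm_sq_def sum_distrib_left sum_divide_distrib)
  finally have 1: "(\<Sum>i<n. (x i)\<^sup>2) = 4 * q / (q + 1)\<^sup>2" .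
  have xn: "x n = s * (q - 1) / (q + 1)" by (simp add: x stereo_def q_def)
  have "(x n)\<^sup>2 = (q - 1)\<^sup>2 / (q + 1)\<^sup>2"
    by (simp add: xn power_divide power_mult_distrib ss)
  then have "norm_sq (n + 1) x = (4 * q + (q - 1)\<^sup>2) / (q + 1)\<^sup>2"
    using 1 by (simp add: norm_sq_def add_divide_distrib)
  also have "4 * q + (q - 1)\<^sup>2 = (q + 1)\<^sup>2" by (simp add: power2_eq_square algebra_simps)
  finally have "norm_sq (n + 1) x = 1" using q by simp
  moreover have "x \<in> euclid (n + 1)" unfolding x stereo_def euclid_def by auto
  moreover have "x n \<noteq> s" using s q by (auto simp: xn divide_simps)
  ultimately show "x \<in> {x \<in> unit_sphere n. x n \<noteq> s}" by (simp add: unit_sphere_def)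
next
  fix x assume "x \<in> {x \<in> unit_sphere n. x n \<noteq> s}"
  then have x: "x \<in> euclid (n + 1)" and nx: "norm_sq (n + 1) x = 1" and xn: "x n \<noteq> s"
    by (auto simp: unit_sphere_def)
  have ss: "s * s = 1" using s by auto
  define c where "c = 1 - s * x n"
  define u where "u = (\<lambda>k\<in>{..<n}. x k / c)"
  have c: "c \<noteq> 0" using xn s by (auto simp: c_def)
  have "norm_sq n x = 1 - (x n)\<^sup>2" using nx by (simp add: norm_sq_def)
  also have "\<dots> = c * (2 - c)"
  proof -
    have "c * (2 - c) = 1 - (s * s) * (x n)\<^sup>2"
      by (simp add: c_def power2_eq_square algebra_simps)
    then show ?thesis by (simp add: ss)
  qed
  finally have nq: "norm_sq n x = c * (2 - c)" .
  have "norm_sq n u = norm_sq n x / c\<^sup>2"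
    by (simp add: norm_sq_def u_def power_divide sum_divide_distrib)
  also have "\<dots> = (2 - c) / c" using c by (simp add: nq power2_eq_square)
  finally have q: "norm_sq n u = (2 - c) / c" .
  have q1: "norm_sq n u + 1 = 2 / c" using c by (simp add: q field_simps)
  have q2: "norm_sq n u - 1 = 2 * (1 - c) / c" using c by (simp add: q field_simps)
  have "stereo n s u = x"
  proof (rule PiE_ext[where k = "{..<n + 1}" and s = "\<lambda>_. UNIV"])
    show "stereo n s u \<in> {..<n + 1} \<rightarrow>\<^sub>E UNIV" by (auto simp: stereo_def)
    show "x \<in> {..<n + 1} \<rightarrow>\<^sub>E UNIV" using x by (simp add: euclid_def)
    fix k assume "k \<in> {..<n + 1}"
    then consider "k < n" | "k = n" by force
    then show "stereo n s u k = x k"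
    proof cases
      case 1
      then show ?thesis using c by (simp add: stereo_def q1) (simp add: u_def)
    next
      case 2
      then have "stereo n s u k = s * (1 - c)" using c by (simp add: stereo_def q1 q2)
      also have "\<dots> = (s * s) * x n" by (simp add: c_def)
      finally show ?thesis using 2 by (simp add: ss)
    qed
  qed
  moreover have "u \<in> euclid n" by (simp add: u_def euclid_def)
  ultimately show "x \<in> stereo n s ` euclid n" by blast
qed

lemma stereo_cover:
  "stereo n 1 ` euclid n \<union> stereo n (- 1) ` euclid n = unit_sphere n"
  by (auto simp: stereo_image)

end

theory Submission
  imports Defs
begin

text \<open>
  In the stereographic chart from the north pole the volume density is \<open>(2 / (1 + \<bar>u\<bar>\<^sup>2))\<^sup>n\<close>, and the
  complement of the strip consists of the ball \<open>\<bar>u\<bar> \<le> r\<close> and the region \<open>\<bar>u\<bar> \<ge> 1 / r\<close> with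
  \<open>r\<^sup>2 = (1 - sin \<epsilon>) / (1 + sin \<epsilon>)\<close>. The dilation by \<open>r\<close> maps the unit ball onto the first region
  and changes the volume element by the factor \<open>(r (1 + \<bar>v\<bar>\<^sup>2) / (1 + r\<^sup>2 \<bar>v\<bar>\<^sup>2))\<^sup>n\<close>, which on the unit
  ball is at most \<open>(2 r / (1 + r\<^sup>2))\<^sup>n = (1 - sin\<^sup>2 \<epsilon>)\<^bsup>n/2\<^esup> \<le> exp (- n sin\<^sup>2 \<epsilon> / 2)\<close>. The dilation by \<open>1 / r\<close>
  gives the same bound for the other region.
\<close>

section \<open>Lebesgue measure on the coordinate space\<close>

lemma space_leb [simp]: "space (leb d) = euclid d"
  by (simp add: leb_def space_PiM euclid_def)

lemma measurable_norm_sq [measurable]: "norm_sq d \<in> borel_measurable (leb d)"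
  unfolding norm_sq_def leb_def by measurable

lemma emeasure_leb_PiE:
  assumes "\<And>i. i < d \<Longrightarrow> A i \<in> sets borel"
  shows "emeasure (leb d) (Pi\<^sub>E {..<d} A) = (\<Prod>i<d. emeasure lborel (A i))"
proof -
  interpret product_sigma_finite "\<lambda>_::nat. lborel :: real measure" ..
  show ?thesis unfolding leb_def using assms by (intro emeasure_PiM) auto
qed

text \<open>The change of variables for u -> r u comes from uniqueness of the product measure: the
  image of \<open>leb d\<close> under the dilation, weighted by \<open>r ^ d\<close>, agrees with
  \<open>leb d\<close> on all boxes, hence everywhere.\<close>

lemma nn_integral_leb_dilation:
  assumes r: "r > 0" and f [measurable]: "f \<in> borel_measurable (leb d)"
  shows "(\<integral>\<^sup>+u. f u \<partial>leb d) = ennreal (r ^ d) * (\<integral>\<^sup>+u. f (\<lambda>i\<in>{..<d}. r * u i) \<partial>leb d)"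
proof -
  interpret product_sigma_finite "\<lambda>_::nat. lborel :: real measure" ..
  let ?D = "\<lambda>u::nat \<Rightarrow> real. \<lambda>i\<in>{..<d}. r * u i"
  have D [measurable]: "?D \<in> measurable (leb d) (leb d)"
    unfolding leb_def by measurable
  define P where "P = density (distr (leb d) (leb d) ?D) (\<lambda>_. ennreal (r ^ d))"
  have "P = PiM {..<d} (\<lambda>_. lborel)"
  proof (rule PiM_eqI)
    show "sets P = sets (PiM {..<d} (\<lambda>_. lborel))" by (simp add: P_def leb_def)
    fix A :: "nat \<Rightarrow> real set" assume A: "\<And>i. i \<in> {..<d} \<Longrightarrow> A i \<in> sets lborel"
    have Am: "Pi\<^sub>E {..<d} A \<in> sets (leb d)"
      unfolding leb_def using A by (intro sets_PiM_I_finite) auto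
    have vim: "?D -` (Pi\<^sub>E {..<d} A) \<inter> space (leb d) = Pi\<^sub>E {..<d} (\<lambda>i. (\<lambda>x. r * x) -` A i)"
      by (auto simp: euclid_def PiE_def Pi_def extensional_def)
    have scale: "ennreal r * emeasure lborel ((\<lambda>x. r * x) -` A i) = emeasure lborel (A i)"
      if "i < d" for i
    proof -
      have Ai: "A i \<in> sets borel" using A that by simp
      have "emeasure lborel ((\<lambda>x. r * x) -` A i) = emeasure (distr lborel borel ((*) r)) (A i)"
        using Ai by (subst emeasure_distr) auto
      also have "\<dots> = ennreal (inverse r) * emeasure lborel (A i)"
        using r Ai by (subst lborel_distr_mult) (auto simp: emeasure_density nn_integral_cmult_indicator)
      finally show ?thesis using r
        by (simp add: mult.assoc [symmetric] ennreal_mult [symmetric])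
    qed
    have "emeasure P (Pi\<^sub>E {..<d} A)
        = ennreal (r ^ d) * emeasure (distr (leb d) (leb d) ?D) (Pi\<^sub>E {..<d} A)"
      using Am by (simp add: P_def emeasure_density nn_integral_cmult_indicator)
    also have "emeasure (distr (leb d) (leb d) ?D) (Pi\<^sub>E {..<d} A)
        = emeasure (leb d) (Pi\<^sub>E {..<d} (\<lambda>i. (\<lambda>x. r * x) -` A i))"
      using Am by (subst emeasure_distr) (auto simp: vim simp del: space_leb)
    also have "\<dots> = (\<Prod>i<d. emeasure lborel ((\<lambda>x. r * x) -` A i))"
    proof (rule emeasure_leb_PiE)
      fix i assume "i < d"
      then have "A i \<in> sets borel" using A by simp
      then show "(\<lambda>x. r * x) -` A i \<in> sets borel"
        using measurable_sets[of "\<lambda>x. r * x" borel borel "A i"] by simp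
    qed
    \<comment> \<open>The weight is distributed as one factor \<open>r\<close> per coordinate, so
      that the one-dimensional \<open>scale\<close> applies on every axis.\<close>
    also have "ennreal (r ^ d) * \<dots> = (\<Prod>i<d. ennreal r * emeasure lborel ((\<lambda>x. r * x) -` A i))"
      using r by (simp add: prod.distrib ennreal_power)
    also have "\<dots> = (\<Prod>i<d. emeasure lborel (A i))"
      by (intro prod.cong) (auto simp: scale)
    finally show "emeasure P (Pi\<^sub>E {..<d} A) = (\<Prod>i\<in>{..<d}. emeasure lborel (A i))" .
  qed auto
  then have "(\<integral>\<^sup>+u. f u \<partial>leb d) = (\<integral>\<^sup>+u. f u \<partial>P)" by (simp add: leb_def)
  also have "\<dots> = ennreal (r ^ d) * (\<integral>\<^sup>+u. f u \<partial>distr (leb d) (leb d) ?D)"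
    unfolding P_def by (subst nn_integral_density) (auto simp: nn_integral_cmult)
  also have "(\<integral>\<^sup>+u. f u \<partial>distr (leb d) (leb d) ?D) = (\<integral>\<^sup>+u. f (?D u) \<partial>leb d)"
    by (rule nn_integral_distr) auto
  finally show ?thesis .
qed


section \<open>The volume density of the stereographic chart\<close>

lemma norm_sq_fun_upd:
  "i < n \<Longrightarrow> norm_sq n (u(i := t)) = t\<^sup>2 + (norm_sq n u - (u i)\<^sup>2)"
  by (simp add: norm_sq_def sum.remove[of "{..<n}" i])

text \<open>On the line through \<open>u\<close> in direction \<open>i\<close>,
  \<open>norm_sq\<close> is t^2 + Q with Q constant, so the quotient rule in one variable
  suffices.\<close>

lemma partial_deriv_stereo:
  assumes i: "i < n" and k: "k < n"
  shows "partial_deriv (stereo n s) i u k =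
    (if k = i then 2 / (norm_sq n u + 1) else 0) - 4 * u i * u k / (norm_sq n u + 1)\<^sup>2"
proof -
  define Q where "Q = norm_sq n u - (u i)\<^sup>2"
  \<comment> \<open>Q collects the squares of the other coordinates; reading it as a value of
    \<open>norm_sq\<close> shows Q \<ge> 0, so the denominator never vanishes.\<close>
  have "norm_sq n (u(i := 0)) = Q" using i by (simp add: norm_sq_fun_upd Q_def)
  then have Q: "Q \<ge> 0" using norm_sq_nonneg by metis
  have pos: "t\<^sup>2 + Q + 1 > 0" for t :: real using Q by (simp add: add_nonneg_pos)
  have q: "norm_sq n u = (u i)\<^sup>2 + Q" by (simp add: Q_def)
  have eq: "(\<lambda>t. stereo n s (u(i := t)) k) = (\<lambda>t. 2 * (if k = i then t else u k) / (t\<^sup>2 + Q + 1))"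
    using i k by (auto simp: stereo_def norm_sq_fun_upd Q_def)
  have "((\<lambda>t. 2 * (if k = i then t else u k) / (t\<^sup>2 + Q + 1)) has_field_derivative
      (if k = i then 2 / ((u i)\<^sup>2 + Q + 1) else 0) - 4 * u i * u k / ((u i)\<^sup>2 + Q + 1)\<^sup>2) (at (u i))"
  proof (cases "k = i")
    case True
    have quot: "(2 * p - 2 * x * (2 * x)) / (p * p) = 2 / p - 4 * x * x / p\<^sup>2" if "p > 0" for p x :: real
      using that by (simp add: field_simps power2_eq_square)
    have "((\<lambda>t. 2 * t / (t\<^sup>2 + Q + 1)) has_field_derivative
        (2 * ((u i)\<^sup>2 + Q + 1) - 2 * u i * (2 * u i)) / (((u i)\<^sup>2 + Q + 1) * ((u i)\<^sup>2 + Q + 1))) (at (u i))"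
      using pos[of "u i"] by (auto intro!: derivative_eq_intros)
    also have "(2 * ((u i)\<^sup>2 + Q + 1) - 2 * u i * (2 * u i)) / (((u i)\<^sup>2 + Q + 1) * ((u i)\<^sup>2 + Q + 1))
        = 2 / ((u i)\<^sup>2 + Q + 1) - 4 * u i * u i / ((u i)\<^sup>2 + Q + 1)\<^sup>2"
      using quot[OF pos[of "u i"]] .
    finally show ?thesis using True by simp
  next
    case False
    have "((\<lambda>t. 2 * u k / (t\<^sup>2 + Q + 1)) has_field_derivative
        - (2 * u k * (2 * u i)) / (((u i)\<^sup>2 + Q + 1) * ((u i)\<^sup>2 + Q + 1))) (at (u i))"
      using pos[of "u i"] by (auto intro!: derivative_eq_intros)
    then show ?thesis using False by (simp add: power2_eq_square[of "_ + 1"] mult_ac)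
  qed
  then show ?thesis unfolding partial_deriv_def eq q by (simp add: DERIV_imp_deriv)
qed

lemma partial_deriv_stereo_last:
  assumes i: "i < n"
  shows "partial_deriv (stereo n s) i u n = 4 * s * u i / (norm_sq n u + 1)\<^sup>2"
proof -
  define Q where "Q = norm_sq n u - (u i)\<^sup>2"
  have "norm_sq n (u(i := 0)) = Q" using i by (simp add: norm_sq_fun_upd Q_def)
  then have Q: "Q \<ge> 0" using norm_sq_nonneg by metis
  have pos: "t\<^sup>2 + Q + 1 > 0" for t :: real using Q by (simp add: add_nonneg_pos)
  have q: "norm_sq n u = (u i)\<^sup>2 + Q" by (simp add: Q_def)
  have eq: "(\<lambda>t. stereo n s (u(i := t)) n) = (\<lambda>t. s * (t\<^sup>2 + Q - 1) / (t\<^sup>2 + Q + 1))"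
    using i by (auto simp: stereo_def norm_sq_fun_upd Q_def)
  have "((\<lambda>t. s * (t\<^sup>2 + Q - 1) / (t\<^sup>2 + Q + 1)) has_field_derivative
      4 * s * u i / ((u i)\<^sup>2 + Q + 1)\<^sup>2) (at (u i))"
  proof -
    have "((\<lambda>t. s * (t\<^sup>2 + Q - 1) / (t\<^sup>2 + Q + 1)) has_field_derivative
        (s * (2 * u i) * ((u i)\<^sup>2 + Q + 1) - s * ((u i)\<^sup>2 + Q - 1) * (2 * u i))
          / (((u i)\<^sup>2 + Q + 1) * ((u i)\<^sup>2 + Q + 1))) (at (u i))"
      using pos[of "u i"] by (auto intro!: derivative_eq_intros)
    also have "s * (2 * u i) * ((u i)\<^sup>2 + Q + 1) - s * ((u i)\<^sup>2 + Q - 1) * (2 * u i) = 4 * s * u i"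
      by (simp add: algebra_simps)
    finally show ?thesis by (simp add: power2_eq_square[of "_ + 1"])
  qed
  then show ?thesis unfolding partial_deriv_def eq q by (simp add: DERIV_imp_deriv)
qed

text \<open>Stereographic projection is conformal with factor a = 2 / (\<open>norm_sq n u\<close> +
  1). The terms off the scalar part combine to a multiple of a (\<open>norm_sq n u\<close> + 1) - 2
  = 0. The pole enters only through s^2 = 1, so both charts have the same metric.\<close>

lemma induced_metric_stereo:
  assumes s: "s\<^sup>2 = 1"
  shows "induced_metric n (n + 1) (stereo n s) u = (2 / (norm_sq n u + 1))\<^sup>2 \<cdot>\<^sub>m 1\<^sub>m n"
proof (rule eq_matI)
  fix i j assume "i < dim_row ((2 / (norm_sq n u + 1))\<^sup>2 \<cdot>\<^sub>m 1\<^sub>m n)"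
    and "j < dim_col ((2 / (norm_sq n u + 1))\<^sup>2 \<cdot>\<^sub>m 1\<^sub>m n)"
  then have i: "i < n" and j: "j < n" by auto
  define a where "a = 2 / (norm_sq n u + 1)"
  have a: "a * (norm_sq n u + 1) = 2" "2 / (norm_sq n u + 1) = a" "4 / (norm_sq n u + 1)\<^sup>2 = a\<^sup>2"
    using norm_sq_nonneg[of n u] by (auto simp: a_def power_divide divide_eq_eq)
  have d: "partial_deriv (stereo n s) i u k = (if k = i then a else 0) - a\<^sup>2 * u i * u k"
    if "i < n" "k < n" for i k
    using partial_deriv_stereo[OF that, of s u] by (simp add: a(2) a(3)[symmetric])
  have d': "partial_deriv (stereo n s) i u n = s * a\<^sup>2 * u i" if "i < n" for i
    using partial_deriv_stereo_last[OF that, of s u] by (simp add: a(3)[symmetric])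
  \<comment> \<open>The product is expanded into Kronecker deltas in \<open>k\<close> and one term
    in (u k)^2, so that the sum collapses to single entries plus a multiple of
    \<open>norm_sq n u\<close>.\<close>
  have "(\<Sum>k<n. partial_deriv (stereo n s) i u k * partial_deriv (stereo n s) j u k)
      = (\<Sum>k<n. (if k = i then (if i = j then a\<^sup>2 else 0) else 0)
               - (if k = i then a ^ 3 * u i * u j else 0)
               - (if k = j then a ^ 3 * u i * u j else 0)
               + a ^ 4 * u i * u j * (u k)\<^sup>2)"
    using i j
    by (intro sum.cong) (auto simp: d algebra_simps power2_eq_square eval_nat_numeral)
  also have "\<dots> = (if i = j then a\<^sup>2 else 0) - 2 * (a ^ 3 * u i * u j) + a ^ 4 * u i * u j * norm_sq n u"
    using i j by (simp add: sum.distrib sum_subtractf norm_sq_def sum_distrib_left)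
  finally have "(\<Sum>k<n+1. partial_deriv (stereo n s) i u k * partial_deriv (stereo n s) j u k)
     = (if i = j then a\<^sup>2 else 0) - 2 * (a ^ 3 * u i * u j) + a ^ 4 * u i * u j * norm_sq n u
       + s\<^sup>2 * (a ^ 4 * u i * u j)"
    using i j by (simp add: d' power2_eq_square eval_nat_numeral mult_ac)
  also have "\<dots> = (if i = j then a\<^sup>2 else 0) + a ^ 3 * u i * u j * (a * (norm_sq n u + 1) - 2)"
    unfolding s by (simp add: algebra_simps eval_nat_numeral)
  also have "\<dots> = (if i = j then a\<^sup>2 else 0)" by (simp add: a(1))
  finally show "induced_metric n (n + 1) (stereo n s) u $$ (i, j)
      = ((2 / (norm_sq n u + 1))\<^sup>2 \<cdot>\<^sub>m 1\<^sub>m n) $$ (i, j)"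
    using i j by (simp add: induced_metric_def a(2))
qed (auto simp: induced_metric_def)

definition stereo_density :: "nat \<Rightarrow> (nat \<Rightarrow> real) \<Rightarrow> real" where
  "stereo_density n u = (2 / (norm_sq n u + 1)) ^ n"

lemma measurable_stereo_density [measurable]: "stereo_density n \<in> borel_measurable (leb n)"
  unfolding stereo_density_def by measurable

lemma stereo_density_pos: "stereo_density n u > 0"
  using norm_sq_nonneg[of n u] by (simp add: stereo_density_def add_nonneg_pos)

lemma sqrt_det_induced_metric_stereo:
  assumes "s\<^sup>2 = 1"
  shows "sqrt (Determinant.det (induced_metric n (n + 1) (stereo n s) u)) = stereo_density n u"
proof -
  have "sqrt (((2 / (norm_sq n u + 1))\<^sup>2) ^ n) = stereo_density n u"
    using norm_sq_nonneg[of n u]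
    by (simp add: stereo_density_def power_mult[symmetric] mult.commute real_sqrt_power[symmetric]
        real_sqrt_unique)
  then show ?thesis unfolding induced_metric_stereo[OF assms] by simp
qed

text \<open>The second chart only contributes the north pole, a null set unless \<open>n = 0\<close>.\<close>

lemma riemannian_volume_sphere:
  assumes n: "n > 0" and A: "A \<subseteq> unit_sphere n"
  shows "riemannian_volume n (n + 1) [stereo n 1, stereo n (- 1)] A
    = (\<integral>\<^sup>+u. ennreal (stereo_density n u) * indicator A (stereo n 1 u) \<partial>leb n)"
proof -
  \<comment> \<open>The second chart reaches the north pole only from the origin \<open>z\<close>.
    As a product of \<open>n\<close> one-point sets, {z} is null once n > 0; for n = 0 it would have
    measure 1.\<close>
  define z where "z = (\<lambda>i\<in>{..<n}. 0::real)"
  have zP: "{z} = Pi\<^sub>E {..<n} (\<lambda>_. {0})"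
    by (auto simp: z_def PiE_def Pi_def extensional_def)
  have "emeasure (leb n) {z} = 0" unfolding zP using n by (subst emeasure_leb_PiE) auto
  moreover have "{z} \<in> sets (leb n)" unfolding zP leb_def by (intro sets_PiM_I_finite) auto
  ultimately have "{z} \<in> null_sets (leb n)" by auto
  then have AEz: "AE u in leb n. u \<noteq> z" using AE_not_in by fastforce
  have zero: "(\<integral>\<^sup>+u. ennreal (stereo_density n u)
      * indicator (A - stereo n 1 ` euclid n) (stereo n (- 1) u) \<partial>leb n) = (\<integral>\<^sup>+u. 0 \<partial>leb n)"
  proof (rule nn_integral_cong_AE)
    show "AE u in leb n. ennreal (stereo_density n u)
        * indicator (A - stereo n 1 ` euclid n) (stereo n (- 1) u) = 0"
      using AEz AE_space
    proof eventually_elim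
      case (elim u)
      have "stereo n (- 1) u \<notin> A - stereo n 1 ` euclid n"
      proof
        assume "stereo n (- 1) u \<in> A - stereo n 1 ` euclid n"
        then have "stereo n (- 1) u n = 1" using A by (auto simp: stereo_image)
        then have "norm_sq n u = 0" using norm_sq_nonneg[of n u]
          by (auto simp: stereo_def divide_simps)
        then have "u i = 0" if "i < n" for i
          using that by (simp add: norm_sq_def sum_nonneg_eq_0_iff)
        then have "u = z" using elim(2) by (auto simp: z_def euclid_def PiE_def extensional_def)
        then show False using elim(1) by simp
      qed
      then show ?case by simp
    qed
  qed
  then show ?thesis
    unfolding riemannian_volume_def
    by (simp add: sqrt_det_induced_metric_stereo[simplified] numeral_2_eq_2 lessThan_Suc)
qed

section \<open>The total volume\<close>

text \<open>Each of the \<open>n\<close> factors 2 / (\<open>norm_sq n u\<close> + 1) is bounded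
  using a different coordinate, by 2 / (1 + (u i)^2). The dominating function is a product, so its
  integral is a power of a one-dimensional integral, finite because arctan is bounded.\<close>

lemma total_volume_finite: "(\<integral>\<^sup>+u. ennreal (stereo_density n u) \<partial>leb n) < \<infinity>"
proof -
  interpret product_sigma_finite "\<lambda>_::nat. lborel :: real measure" ..
  have "(\<integral>\<^sup>+u. ennreal (stereo_density n u) \<partial>leb n)
      \<le> (\<integral>\<^sup>+u. (\<Prod>i<n. ennreal (2 / (1 + (u i)\<^sup>2))) \<partial>leb n)"
  proof (rule nn_integral_mono)
    fix u
    have "stereo_density n u = (\<Prod>i<n. 2 / (norm_sq n u + 1))"
      by (simp add: stereo_density_def)
    also have "\<dots> \<le> (\<Prod>i<n. 2 / (1 + (u i)\<^sup>2))"
    proof (intro prod_mono conjI)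
      fix i assume "i \<in> {..<n}"
      then have "(u i)\<^sup>2 \<le> norm_sq n u"
        unfolding norm_sq_def by (intro member_le_sum) auto
      then show "2 / (norm_sq n u + 1) \<le> 2 / (1 + (u i)\<^sup>2)"
        by (intro divide_left_mono) (auto simp: add_nonneg_pos add_pos_nonneg norm_sq_nonneg)
      show "0 \<le> 2 / (norm_sq n u + 1)" using norm_sq_nonneg[of n u] by simp
    qed
    finally have "ennreal (stereo_density n u) \<le> ennreal (\<Prod>i<n. 2 / (1 + (u i)\<^sup>2))"
      by (rule ennreal_leI)
    then show "ennreal (stereo_density n u) \<le> (\<Prod>i<n. ennreal (2 / (1 + (u i)\<^sup>2)))"
      by (simp add: prod_ennreal)
  qed
  also have "\<dots> = (\<Prod>i<n. \<integral>\<^sup>+x. ennreal (2 / (1 + x\<^sup>2)) \<partial>lborel)"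
    unfolding leb_def by (rule product_nn_integral_prod) auto
  also have "\<dots> < \<infinity>"
  proof -
    have "(\<integral>\<^sup>+x. ennreal (2 / (1 + x\<^sup>2)) \<partial>lborel) < \<infinity>"
    proof -
      have "set_integrable lborel (einterval (- \<infinity>) \<infinity>) (\<lambda>x::real. inverse (1 + x\<^sup>2))"
      proof (rule interval_integral_FTC_nonneg(1)[where F = arctan])
        show "((arctan \<circ> real_of_ereal) \<longlongrightarrow> - (pi / 2)) (at_right (- \<infinity>))"
          unfolding ereal_tendsto_simps by (rule tendsto_arctan_at_bot)
        show "((arctan \<circ> real_of_ereal) \<longlongrightarrow> pi / 2) (at_left \<infinity>)"
          unfolding ereal_tendsto_simps by (rule tendsto_arctan_at_top)
      qed (auto intro!: continuous_intros DERIV_arctan simp: add_nonneg_eq_0_iff)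
      then have "integrable lborel (\<lambda>x::real. 1 / (1 + x\<^sup>2))"
        by (simp add: set_integrable_def inverse_eq_divide)
      then have "integrable lborel (\<lambda>x::real. 2 * (1 / (1 + x\<^sup>2)))" by (rule integrable_mult_right)
      then show ?thesis
        by (subst nn_integral_eq_integral) (auto simp: add_nonneg_nonneg)
    qed
    then show ?thesis by (simp add: less_top[symmetric] power_eq_top_ennreal)
  qed
  finally show ?thesis .
qed

text \<open>A strictly positive density with zero integral would make the whole space null, but as a
  box the space has a product of infinite factors as its measure (1 when n = 0).\<close>

lemma total_volume_pos: "(\<integral>\<^sup>+u. ennreal (stereo_density n u) \<partial>leb n) > 0"
proof (rule ccontr)
  assume "\<not> ?thesis"
  then have "(\<integral>\<^sup>+u. ennreal (stereo_density n u) \<partial>leb n) = 0" by simp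
  then have "AE u in leb n. ennreal (stereo_density n u) = 0"
    by (subst (asm) nn_integral_0_iff_AE) auto
  then have "AE u in leb n. False"
  proof eventually_elim
    case (elim u)
    then show ?case using stereo_density_pos[of n u] by simp
  qed
  then have "emeasure (leb n) (space (leb n)) = 0"
    by (subst (asm) AE_iff_measurable[OF sets.top]) auto
  then show False
    unfolding space_leb euclid_def by (subst (asm) emeasure_leb_PiE) auto
qed

section \<open>Caps\<close>

text \<open>
  The sign condition covers two cases at once: the ball \<open>\<bar>u\<bar> \<le> r\<close> when \<open>r < 1\<close>, and the complement
  \<open>\<bar>u\<bar> \<ge> r\<close> when \<open>r > 1\<close>.
\<close>

lemma cap_volume_le:
  assumes r: "r > 0"
  shows "(\<integral>\<^sup>+u. ennreal (stereo_density n u)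
            * indicator {u. 0 \<le> (1 - r\<^sup>2) * (r\<^sup>2 - norm_sq n u)} u \<partial>leb n)
    \<le> ennreal ((2 * r / (1 + r\<^sup>2)) ^ n) * (\<integral>\<^sup>+u. ennreal (stereo_density n u) \<partial>leb n)"
proof -
  let ?D = "\<lambda>u::nat \<Rightarrow> real. \<lambda>i\<in>{..<n}. r * u i"
  have ns: "norm_sq n (?D u) = r\<^sup>2 * norm_sq n u" for u
    by (simp add: norm_sq_def power_mult_distrib sum_distrib_left)
  have [measurable]: "?D \<in> measurable (leb n) (leb n)"
    unfolding leb_def by measurable
  have "(\<integral>\<^sup>+u. ennreal (stereo_density n u)
            * indicator {u. 0 \<le> (1 - r\<^sup>2) * (r\<^sup>2 - norm_sq n u)} u \<partial>leb n)
     = ennreal (r ^ n) * (\<integral>\<^sup>+u. ennreal (stereo_density n (?D u))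
            * indicator {u. 0 \<le> (1 - r\<^sup>2) * (r\<^sup>2 - norm_sq n u)} (?D u) \<partial>leb n)"
    by (rule nn_integral_leb_dilation[OF r]) measurable
  also have "\<dots> = (\<integral>\<^sup>+u. ennreal (r ^ n) * (ennreal (stereo_density n (?D u))
            * indicator {u. 0 \<le> (1 - r\<^sup>2) * (r\<^sup>2 - norm_sq n u)} (?D u)) \<partial>leb n)"
    by (rule nn_integral_cmult[symmetric]) measurable
  also have "\<dots> \<le> (\<integral>\<^sup>+u. ennreal ((2 * r / (1 + r\<^sup>2)) ^ n) * ennreal (stereo_density n u) \<partial>leb n)"
  proof (rule nn_integral_mono)
    fix u
    define w where "w = norm_sq n u"
    have w: "w \<ge> 0" by (simp add: w_def norm_sq_nonneg)
    show "ennreal (r ^ n) * (ennreal (stereo_density n (?D u))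
            * indicator {u. 0 \<le> (1 - r\<^sup>2) * (r\<^sup>2 - norm_sq n u)} (?D u))
        \<le> ennreal ((2 * r / (1 + r\<^sup>2)) ^ n) * ennreal (stereo_density n u)"
    proof (cases "0 \<le> (1 - r\<^sup>2) * (r\<^sup>2 - norm_sq n (?D u))")
      \<comment> \<open>At the dilated point the sign condition is r^2 times (1 - r^2) (1 - w). That
        last product is exactly the difference of the two sides of \<open>le\<close>, which explains
        why one condition serves both r < 1 and r > 1.\<close>
      case True
      then have "0 \<le> r\<^sup>2 * ((1 - r\<^sup>2) * (1 - w))"
        by (simp add: ns w_def algebra_simps)
      then have "0 \<le> (1 - r\<^sup>2) * (1 - w)"
        using r by (simp add: zero_le_mult_iff)
      then have le: "(w + 1) * (1 + r\<^sup>2) \<le> 2 * (r\<^sup>2 * w + 1)" by (simp add: algebra_simps)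
      have p: "r\<^sup>2 * w + 1 > 0" "1 + r\<^sup>2 > 0" "w + 1 > 0"
        using w by (auto simp: add_nonneg_pos add_pos_nonneg)
      have "r * (2 / (r\<^sup>2 * w + 1)) \<le> 2 * r / (1 + r\<^sup>2) * (2 / (w + 1))"
      proof -
        have "2 * r * ((w + 1) * (1 + r\<^sup>2)) \<le> 2 * r * (2 * (r\<^sup>2 * w + 1))"
          using le r by (intro mult_left_mono) auto
        then show ?thesis using p by (simp add: divide_le_eq le_divide_eq mult_ac)
      qed
      then have "(r * (2 / (r\<^sup>2 * w + 1))) ^ n \<le> (2 * r / (1 + r\<^sup>2) * (2 / (w + 1))) ^ n"
        using r p by (intro power_mono) auto
      then have "r ^ n * stereo_density n (?D u) \<le> (2 * r / (1 + r\<^sup>2)) ^ n * stereo_density n u"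
        unfolding stereo_density_def ns w_def[symmetric] by (simp only: power_mult_distrib)
      then show ?thesis
        using True r stereo_density_pos[of n u] stereo_density_pos[of n "?D u"]
        by (simp add: ennreal_mult[symmetric] less_imp_le ennreal_leI)
    qed simp
  qed
  also have "\<dots> = ennreal ((2 * r / (1 + r\<^sup>2)) ^ n) * (\<integral>\<^sup>+u. ennreal (stereo_density n u) \<partial>leb n)"
    by (rule nn_integral_cmult) measurable
  finally show ?thesis .
qed

section \<open>Comparing the strip with the whole sphere\<close>

text \<open>Positivity of the total volume allows division, the upper bound keeps the ratio below 1
  for the limit, and the lower bound subtracts two caps of relative volume at most C^n each.\<close>

lemma strip_volume_bounds:
  assumes n: "n > 0" and \<epsilon>: "0 < \<epsilon>" "\<epsilon> < pi / 2"
  shows "sphere_vol n (unit_sphere n) > 0"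
    and "sphere_vol n (strip n \<epsilon>) \<le> sphere_vol n (unit_sphere n)"
    and "sphere_vol n (strip n \<epsilon>)
      \<ge> (1 - 2 * exp (- (sin \<epsilon>)\<^sup>2 / 2) ^ n) * sphere_vol n (unit_sphere n)"
proof -
  define s where "s = sin \<epsilon>"
  have s0: "0 < s" unfolding s_def using \<epsilon> by (intro sin_gt_zero) auto
  have s1: "s < 1"
    using sin_monotone_2pi[of \<epsilon> "pi / 2"] \<epsilon> by (simp add: s_def)
  \<comment> \<open>The height (q - 1) / (q + 1) at squared radius q equals -s for q = (1 - s) / (1
    + s) and s for the reciprocal of this value.\<close>
  define r where "r = sqrt ((1 - s) / (1 + s))"
  have r: "r > 0" and r2: "r\<^sup>2 = (1 - s) / (1 + s)" using s0 s1 by (auto simp: r_def)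
  define C where "C = 2 * r / (1 + r\<^sup>2)"
  have C0: "C \<ge> 0" using r by (simp add: C_def)
  have C: "C \<le> exp (- s\<^sup>2 / 2)"
  \<comment> \<open>Squaring removes the root in \<open>r\<close>: C^2 = 1 - s^2, to which 1 + x
    \<le> exp x applies.\<close>
  proof (rule power2_le_imp_le)
    have 1: "1 + r\<^sup>2 = 2 / (1 + s)" using s0 by (simp add: r2 field_simps)
    have "C\<^sup>2 = 4 * r\<^sup>2 / (1 + r\<^sup>2)\<^sup>2" by (simp add: C_def power_divide power_mult_distrib)
    also have "\<dots> = 1 - s\<^sup>2"
      unfolding 1 unfolding r2 using s0 by (simp add: power_divide field_simps power2_eq_square)
    also have "\<dots> \<le> exp (- s\<^sup>2)" using exp_ge_add_one_self[of "- s\<^sup>2"] by simp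
    also have "\<dots> = (exp (- s\<^sup>2 / 2))\<^sup>2" by (simp add: exp_double[symmetric])
    finally show "C\<^sup>2 \<le> (exp (- s\<^sup>2 / 2))\<^sup>2" .
  qed simp
  \<comment> \<open>The contraction factor is invariant under r -> 1 / r, so both caps obey the same
    bound.\<close>
  have C': "2 * (1 / r) / (1 + (1 / r)\<^sup>2) = C"
    using r by (simp add: C_def field_simps power2_eq_square)
  let ?F = "\<lambda>u. ennreal (stereo_density n u)"
  define T where "T = (\<integral>\<^sup>+u. ?F u \<partial>leb n)"
  define V where "V = (\<integral>\<^sup>+u. ?F u * indicator (strip n \<epsilon>) (stereo n 1 u) \<partial>leb n)"
  let ?K = "\<lambda>r. {u. 0 \<le> (1 - r\<^sup>2) * (r\<^sup>2 - norm_sq n u)}"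
  have on_sphere: "stereo n 1 u \<in> unit_sphere n" if "u \<in> euclid n" for u
    using stereo_cover that by blast
  have height: "stereo n 1 u n = (norm_sq n u - 1) / (norm_sq n u + 1)" for u
    by (simp add: stereo_def)
  have "riemannian_volume n (n + 1) [stereo n 1, stereo n (- 1)] (unit_sphere n) = T"
    unfolding T_def riemannian_volume_sphere[OF n subset_refl]
    by (intro nn_integral_cong) (simp add: on_sphere)
  then have T: "sphere_vol n (unit_sphere n) = enn2real T" by (simp add: sphere_vol_def)
  have "strip n \<epsilon> \<subseteq> unit_sphere n" by (auto simp: strip_def)
  from riemannian_volume_sphere[OF n this]
  have V: "sphere_vol n (strip n \<epsilon>) = enn2real V" by (simp add: sphere_vol_def V_def)
  have Tfin: "T < \<infinity>" "T > 0" using total_volume_finite total_volume_pos by (auto simp: T_def)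
  then show "sphere_vol n (unit_sphere n) > 0" unfolding T by (simp add: enn2real_positive_iff)
  have VT: "V \<le> T" unfolding V_def T_def by (intro nn_integral_mono) (auto split: split_indicator)
  then show "sphere_vol n (strip n \<epsilon>) \<le> sphere_vol n (unit_sphere n)"
    unfolding T V using Tfin by (intro enn2real_mono) auto
  \<comment> \<open>The strip is rewritten in chart coordinates through the height alone, which
    makes the measurability needed to split the integral immediate.\<close>
  define W where "W = (\<lambda>u. indicator {u. - s < (norm_sq n u - 1) / (norm_sq n u + 1)
      \<and> (norm_sq n u - 1) / (norm_sq n u + 1) < s} u :: ennreal)"
  have [measurable]: "W \<in> borel_measurable (leb n)" unfolding W_def by measurable
  have V_W: "V = (\<integral>\<^sup>+u. ?F u * W u \<partial>leb n)"
    unfolding V_def W_def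
    by (intro nn_integral_cong) (auto simp: strip_def on_sphere height s_def split: split_indicator)
  \<comment> \<open>Pointwise, every \<open>u\<close> lies in the strip or in one of the two caps;
    overlaps are harmless since only an upper bound for \<open>T\<close> is wanted.\<close>
  have "T \<le> (\<integral>\<^sup>+u. ?F u * W u + (?F u * indicator (?K r) u + ?F u * indicator (?K (1 / r)) u) \<partial>leb n)"
    unfolding T_def
  proof (rule nn_integral_mono)
    fix u
    define q where "q = norm_sq n u"
    have q: "q + 1 > 0" using norm_sq_nonneg[of n u] by (simp add: q_def)
    have r1: "r\<^sup>2 < 1" unfolding r2 using s0 by simp
    consider "- s < (q - 1) / (q + 1)" "(q - 1) / (q + 1) < s" | "(q - 1) / (q + 1) \<le> - s"
      | "(q - 1) / (q + 1) \<ge> s" by linarith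
    then show "?F u \<le> ?F u * W u + (?F u * indicator (?K r) u + ?F u * indicator (?K (1 / r)) u)"
    proof cases
      case 1
      then have "W u = 1" by (simp add: W_def q_def)
      then show ?thesis by simp
    next
      case 2
      then have "q - 1 \<le> - s * (q + 1)" using q by (simp add: divide_le_eq)
      then have "q \<le> r\<^sup>2" unfolding r2 using s0 by (simp add: le_divide_eq algebra_simps)
      then have "u \<in> ?K r" using r1 by (simp add: q_def[symmetric])
      then show ?thesis by (simp add: add_increasing)
    next
      case 3
      then have "s * (q + 1) \<le> q - 1" using q by (simp add: le_divide_eq)
      then have "(1 / r)\<^sup>2 \<le> q" unfolding power_divide r2 using s0 s1
        by (simp add: divide_le_eq algebra_simps)
      \<comment> \<open>For radius 1 / r both factors of the sign condition are nonpositive, whereas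
        for \<open>r\<close> both were nonnegative.\<close>
      moreover have "1 \<le> (1 / r)\<^sup>2" using r r1 by (simp add: power_divide)
      ultimately have "u \<in> ?K (1 / r)"
        by (simp add: q_def[symmetric] mult_nonpos_nonpos)
      then show ?thesis by (simp add: add_increasing)
    qed
  qed
  also have "\<dots> = V + ((\<integral>\<^sup>+u. ?F u * indicator (?K r) u \<partial>leb n)
      + (\<integral>\<^sup>+u. ?F u * indicator (?K (1 / r)) u \<partial>leb n))"
    unfolding V_W by (simp add: nn_integral_add)
  also have "\<dots> \<le> V + (ennreal (C ^ n) * T + ennreal (C ^ n) * T)"
    using cap_volume_le[OF r, of n] cap_volume_le[of "1 / r" n] r C'
    unfolding T_def C_def by (intro add_mono) auto
  finally have main: "T \<le> V + (ennreal (C ^ n) * T + ennreal (C ^ n) * T)" .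
  \<comment> \<open>All quantities are finite, so the inequality is moved to the reals, where the
    cap terms can be subtracted.\<close>
  obtain t where t: "T = ennreal t" "t > 0" using Tfin by (cases T) auto
  obtain v where v: "V = ennreal v" "v \<ge> 0" using VT Tfin by (cases V) (auto simp: top_unique)
  define k where "k = C ^ n * t"
  have k: "k \<ge> 0" "ennreal (C ^ n) * T = ennreal k"
    using t C0 by (simp_all add: k_def ennreal_mult)
  have "ennreal t \<le> ennreal v + (ennreal k + ennreal k)"
    using main unfolding k(2) unfolding t(1) v(1) .
  also have "\<dots> = ennreal (v + (k + k))"
    using v(2) k(1) by (simp only: ennreal_plus add_nonneg_nonneg)
  finally have "t \<le> v + (k + k)"
    using v k(1) by (subst (asm) ennreal_le_iff) auto
  then have "t \<le> v + 2 * C ^ n * t" by (simp add: k_def mult_ac)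
  moreover have "C ^ n \<le> exp (- s\<^sup>2 / 2) ^ n" using C C0 by (intro power_mono)
  then have "2 * C ^ n * t \<le> 2 * exp (- s\<^sup>2 / 2) ^ n * t"
    using t by (intro mult_right_mono) auto
  ultimately have "(1 - 2 * exp (- s\<^sup>2 / 2) ^ n) * t \<le> v" by (simp add: algebra_simps)
  then show "sphere_vol n (strip n \<epsilon>)
      \<ge> (1 - 2 * exp (- (sin \<epsilon>)\<^sup>2 / 2) ^ n) * sphere_vol n (unit_sphere n)"
    unfolding T V t v using t v by (simp add: s_def)
qed

section \<open>Dimension zero, the constant and the limit\<close>

text \<open>The 0-sphere is the pair of points 1 and -1, and sin \<epsilon> \<le> 1. This case is
  separate because the reduction to a single chart requires n > 0.\<close>

lemma strip_0_empty: "strip 0 \<epsilon> = {}"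
proof -
  have "False" if "x \<in> strip 0 \<epsilon>" for x
  proof -
    have "(x 0)\<^sup>2 = 1" "- sin \<epsilon> < x 0" "x 0 < sin \<epsilon>"
      using that by (auto simp: strip_def unit_sphere_def norm_sq_def)
    moreover have "sin \<epsilon> \<le> 1" by simp
    ultimately show False by (auto simp: power2_eq_1_iff)
  qed
  then show ?thesis by blast
qed

theorem theorem1p2:
  shows "\<exists>\<delta>::real. \<delta> > 0 \<and>
    (\<forall>\<epsilon>::real. 0 < \<epsilon> \<and> \<epsilon> < pi / 2 \<longrightarrow>
      sin \<epsilon> \<in> {0<..<1} \<and>
      (\<forall>n::nat. sphere_vol n (strip n \<epsilon>) / sphere_vol n (unit_sphere n)
                  \<ge> 1 - 4 * exp (- \<delta> * (sin \<epsilon>)\<^sup>2 * (real n + 1))) \<and>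
      (\<lambda>n. sphere_vol n (strip n \<epsilon>) / sphere_vol n (unit_sphere n)) \<longlonglongrightarrow> 1)"
proof (intro exI[of _ "1 / 4"] conjI allI impI)
  fix \<epsilon> :: real assume "0 < \<epsilon> \<and> \<epsilon> < pi / 2"
  then have \<epsilon>: "0 < \<epsilon>" "\<epsilon> < pi / 2" by auto
  have s0: "0 < sin \<epsilon>" using \<epsilon> by (intro sin_gt_zero) auto
  have s1: "sin \<epsilon> < 1" using sin_monotone_2pi[of \<epsilon> "pi / 2"] \<epsilon> by simp
  show "sin \<epsilon> \<in> {0<..<1}" using s0 s1 by simp
  let ?R = "\<lambda>n. sphere_vol n (strip n \<epsilon>) / sphere_vol n (unit_sphere n)"
  let ?B = "\<lambda>n. 1 - 4 * exp (- (1 / 4) * (sin \<epsilon>)\<^sup>2 * (real n + 1))"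
  show lower: "?R n \<ge> ?B n" for n
  proof (cases "n = 0")
    case True
    have R: "?R n = 0"
      by (simp add: True strip_0_empty sphere_vol_def riemannian_volume_def)
    \<comment> \<open>With ratio 0 the claimed lower bound must be nonpositive, that is, the
      exponential must be at least 1/4; 1 + x \<le> exp x gives 3/4.\<close>
    have "(sin \<epsilon>)\<^sup>2 \<le> 1" using s0 s1 by (simp add: power_le_one)
    then have "exp (- (1 / 4) * (sin \<epsilon>)\<^sup>2 * (real n + 1)) \<ge> 3 / 4"
      using exp_ge_add_one_self[of "- (1 / 4) * (sin \<epsilon>)\<^sup>2"] unfolding True by simp
    then show ?thesis unfolding R by simp
  next
    case False
    then have n: "n > 0" by simp
    \<comment> \<open>Since n + 1 \<le> 2 n for n > 0, the rate n / 2 of the strip bound is at least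
      (n + 1) / 4; this is the origin of \<delta> = 1/4.\<close>
    have "(sin \<epsilon>)\<^sup>2 * (real n + 1) \<le> (sin \<epsilon>)\<^sup>2 * (2 * real n)"
      using n by (intro mult_left_mono) auto
    then have "exp (- (sin \<epsilon>)\<^sup>2 / 2) ^ n \<le> exp (- (1 / 4) * (sin \<epsilon>)\<^sup>2 * (real n + 1))"
      by (simp add: exp_of_nat_mult[symmetric] algebra_simps)
    then have "?B n \<le> 1 - 2 * exp (- (sin \<epsilon>)\<^sup>2 / 2) ^ n"
      using exp_gt_zero[of "- (1 / 4) * (sin \<epsilon>)\<^sup>2 * (real n + 1)"] by linarith
    also have "\<dots> \<le> ?R n"
      using strip_volume_bounds[OF n \<epsilon>] by (simp add: le_divide_eq)
    finally show ?thesis .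
  qed
  show "?R \<longlonglongrightarrow> 1"
  proof (rule tendsto_sandwich)
    show "eventually (\<lambda>n. ?B n \<le> ?R n) sequentially" using lower by simp
    show "eventually (\<lambda>n. ?R n \<le> 1) sequentially"
      using eventually_gt_at_top[of 0]
      by eventually_elim (use strip_volume_bounds[OF _ \<epsilon>] in \<open>simp add: divide_le_eq\<close>)
    \<comment> \<open>The lower bound is 1 minus a geometric sequence of ratio exp (- (sin
      \<epsilon>)^2 / 4) < 1; the exponent \<open>Suc n\<close> matches
      \<open>real n + 1\<close>.\<close>
    have "(\<lambda>n. 1 - 4 * exp (- (sin \<epsilon>)\<^sup>2 / 4) ^ Suc n) \<longlonglongrightarrow> 1 - 4 * 0"
      using s0 by (intro tendsto_intros LIMSEQ_Suc LIMSEQ_power_zero) auto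
    then show "?B \<longlonglongrightarrow> 1"
      by (simp add: exp_of_nat_mult[symmetric] algebra_simps add_divide_distrib del: power_Suc)
  qed simp
qed simp

end
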